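(* Assume that $b=c\geq 2$. Let $n\geq 3$. Then \begin{equation*}\begin{aligned} &x_n= x_1^{-a_{n-1}} x_2^{-a_{n-2}} \sum_{e_1,e_2} \sum_{ t_0,t_1,\cdots,t_{n-4}} \left[ \left( \prod_{i=0}^{n-4} \genfrac{[}{]}{0pt}{}{a_{i+1} - cs_i}{t_i} \right) \right.\\ &\qquad\times \left.\genfrac{[}{]}{0pt}{}{a_{n-2} - cs_{n-3}}{a_{n-2} - cs_{n-3}-e_2+s_{n-4}}\genfrac{[}{]}{0pt}{}{-a_{n-3} + c e_2}{-a_{n-3} + c e_2-e_1+s_{n-3}} x_1^{c(a_{n-2}-e_{2})} x_2^{ce_{1}}\right], \end{aligned}\end{equation*} where $s_i=\sum_{j=0}^{i-1} a_{i-j+1}t_j$, and the summations run over all integers $e_1,e_2, t_0,\dots,t_{n-4}$ satisfying $0\leq t_i \leq a_{i+1} - cs_i$ for $0\leq i\leq n-4$, $0\leq a_{n-2} - cs_{n-3}-e_2+s_{n-4}\leq a_{n-2} - cs_{n-3}$, and $e_2 a_{n-1} -e_1 a_{n-2}\geq 0$.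
   Context: Let $b,c$ be positive integers and $x_1,x_2$ indeterminates. The coefficient-free cluster algebra $\mathcal{A}(b,c)$ is the subring of $\mathbb{Q}(x_1,x_2)$ generated by the cluster variables $x_m$, $m\in\mathbb{Z}$, satisfying $x_{n+1}=(x_n^b+1)/x_{n-1}$ if $n$ is odd and $x_{n+1}=(x_n^c+1)/x_{n-1}$ if $n$ is even. The sequence $\{a_n\}$ is defined by $a_1=0$, $a_2=1$, $a_n=ca_{n-1}-a_{n-2}$. For arbitrary (possibly negative) integers $A,B$ the modified binomial coefficient is $\genfrac{[}{]}{0pt}{}{A}{B}=\prod_{i=0}^{A-B-1}\frac{A-i}{A-B-i}$ if $A>B$, $=1$ if $A=B$, and $=0$ if $A<B$. An empty product $\prod_{i=A}^{A-1}f(i)$ is defined to be $1$. *)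

theory Defs
  imports
    "HOL-Computational_Algebra.Polynomial_Factorial"
    "HOL-Library.Groups_Big_Fun"
    "HOL-Library.FuncSet"
begin

text \<open>The field of rational functions in two indeterminates over the rationals, as the
  fraction field of the polynomial ring in \<open>X2\<close> over the polynomial ring in \<open>X1\<close>.\<close>

type_synonym ratfun2 = "rat poly poly fract"

definition X1 :: ratfun2 where
  "X1 = to_fract [:[:0, 1:]:]"

definition X2 :: ratfun2 where
  "X2 = to_fract [:0, 1:]"

definition rf_const :: "rat \<Rightarrow> ratfun2" where
  "rf_const q = to_fract [:[:q:]:]"

text \<open>The exchange relations are solved upwards from \<open>x\<^sub>1, x\<^sub>2\<close> for indices above 2 and
  downwards for indices below 1; lemma \<open>cluster_var_exchange\<close> below shows that they then
  hold at every integer.\<close>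

function cluster_var :: "nat \<Rightarrow> nat \<Rightarrow> int \<Rightarrow> ratfun2" where
  "cluster_var b c m =
     (if m = 1 then X1
      else if m = 2 then X2
      else if m > 2 then
        (cluster_var b c (m - 1) ^ (if odd (m - 1) then b else c) + 1) / cluster_var b c (m - 2)
      else
        (cluster_var b c (m + 1) ^ (if odd (m + 1) then b else c) + 1) / cluster_var b c (m + 2))"
  by auto
termination
  by (relation "measure (\<lambda>(b, c, m). nat \<bar>2 * m - 3\<bar>)") auto

declare cluster_var.simps [simp del]

text \<open>The value at index 0 is forced by reading the recursion at index 2.\<close>

fun a_seq :: "nat \<Rightarrow> nat \<Rightarrow> int" where
  "a_seq c 0 = - 1"
| "a_seq c (Suc 0) = 0"
| "a_seq c (Suc (Suc n)) = int c * a_seq c (Suc n) - a_seq c n"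

lemma a_seq_2: "a_seq c 2 = 1"
  by (simp add: numeral_2_eq_2)

text \<open>The index \<open>-1\<close> (an empty sum) also occurs, as \<open>n - 4\<close> for \<open>n = 3\<close>; natural-number
  subtraction turns it into index 0, where the sum is empty as well.\<close>

definition s_seq :: "nat \<Rightarrow> (nat \<Rightarrow> int) \<Rightarrow> nat \<Rightarrow> int" where
  "s_seq c t i = (\<Sum>j<i. a_seq c (i - j + 1) * t j)"

definition mbinom :: "int \<Rightarrow> int \<Rightarrow> rat" where
  "mbinom A B =
     (if A > B then (\<Prod>i\<in>{0..A - B - 1}. of_int (A - i) / of_int (A - B - i))
      else if A = B then 1
      else 0)"

definition pos_at_1 :: "ratfun2 \<Rightarrow> bool" where
  "pos_at_1 x \<longleftrightarrow> (\<exists>p q. poly (poly p 1) 1 > 0 \<and> poly (poly q 1) 1 > 0 \<and> x = Fract p q)"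

lemma pos_at_1_nonzero: "pos_at_1 x \<Longrightarrow> x \<noteq> 0"
proof
  assume "pos_at_1 x" "x = 0"
  then obtain p q :: "rat poly poly"
    where *: "poly (poly p 1) 1 > 0" "poly (poly q 1) 1 > 0" "Fract p q = 0"
    unfolding pos_at_1_def by auto
  then have "p \<noteq> 0" "q \<noteq> 0" by auto
  with * show False by (simp add: Zero_fract_def eq_fract)
qed

lemma pos_at_1_one: "pos_at_1 1"
  unfolding pos_at_1_def by (rule exI[of _ 1], rule exI[of _ 1]) (simp add: One_fract_def)

lemma pos_at_1_add:
  assumes "pos_at_1 x" "pos_at_1 y" shows "pos_at_1 (x + y)"
proof -
  from assms obtain p q p' q' where
    *: "poly (poly p 1) 1 > 0" "poly (poly q 1) 1 > 0" "x = Fract p q"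
       "poly (poly p' 1) 1 > 0" "poly (poly q' 1) 1 > 0" "y = Fract p' q'"
    unfolding pos_at_1_def by blast
  then have "q \<noteq> 0" "q' \<noteq> 0" by auto
  with * have "x + y = Fract (p * q' + p' * q) (q * q')" by simp
  moreover have "poly (poly (p * q' + p' * q) 1) 1 > 0" "poly (poly (q * q') 1) 1 > 0"
    using * by (simp_all add: add_pos_pos)
  ultimately show ?thesis unfolding pos_at_1_def by blast
qed

lemma pos_at_1_mult:
  assumes "pos_at_1 x" "pos_at_1 y" shows "pos_at_1 (x * y)"
proof -
  from assms obtain p q p' q' where
    *: "poly (poly p 1) 1 > 0" "poly (poly q 1) 1 > 0" "x = Fract p q"
       "poly (poly p' 1) 1 > 0" "poly (poly q' 1) 1 > 0" "y = Fract p' q'"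
    unfolding pos_at_1_def by blast
  then have "x * y = Fract (p * p') (q * q')" by simp
  moreover have "poly (poly (p * p') 1) 1 > 0" "poly (poly (q * q') 1) 1 > 0"
    using * by simp_all
  ultimately show ?thesis unfolding pos_at_1_def by blast
qed

lemma pos_at_1_inverse: "pos_at_1 x \<Longrightarrow> pos_at_1 (inverse x)"
  unfolding pos_at_1_def by (metis inverse_fract)

lemma pos_at_1_power: "pos_at_1 x \<Longrightarrow> pos_at_1 (x ^ n)"
  by (induction n) (auto intro: pos_at_1_one pos_at_1_mult)

lemma pos_at_1_X: "pos_at_1 X1" "pos_at_1 X2"
  unfolding pos_at_1_def X1_def X2_def to_fract_def
  by (rule exI[of _ "[:[:0, 1:]:]"], rule exI[of _ 1], simp)
     (rule exI[of _ "[:0, 1:]"], rule exI[of _ 1], simp)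

lemma pos_at_1_step: "pos_at_1 x \<Longrightarrow> pos_at_1 y \<Longrightarrow> pos_at_1 ((x ^ k + 1) / y)"
  unfolding divide_inverse
  by (intro pos_at_1_mult pos_at_1_add pos_at_1_power pos_at_1_one pos_at_1_inverse)

lemma pos_at_1_cluster_var: "pos_at_1 (cluster_var b c m)"
proof (induction b c m rule: cluster_var.induct)
  case (1 b c m)
  then show ?case
    by (subst cluster_var.simps)
       (simp only: pos_at_1_X pos_at_1_step split: if_split, blast intro: pos_at_1_X pos_at_1_step)
qed

lemma cluster_var_nonzero: "cluster_var b c m \<noteq> 0"
  by (rule pos_at_1_nonzero[OF pos_at_1_cluster_var])

lemma cluster_var_exchange:
  "cluster_var b c (n + 1) =
     (cluster_var b c n ^ (if odd n then b else c) + 1) / cluster_var b c (n - 1)"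
proof (cases "n \<ge> 2")
  case True
  then show ?thesis by (subst cluster_var.simps) simp
next
  case False
  then have "cluster_var b c (n - 1) =
      (cluster_var b c n ^ (if odd n then b else c) + 1) / cluster_var b c (n + 1)"
    by (subst cluster_var.simps) (simp add: add.commute)
  then have "cluster_var b c (n - 1) * cluster_var b c (n + 1) =
      cluster_var b c n ^ (if odd n then b else c) + 1"
    using cluster_var_nonzero[of b c "n + 1"] by simp
  then show ?thesis
    using cluster_var_nonzero[of b c "n - 1"] by (metis nonzero_mult_div_cancel_left)
qed

lemma cluster_var_1: "cluster_var b c 1 = X1"
  and cluster_var_2: "cluster_var b c 2 = X2"
  by (simp_all add: cluster_var.simps)

end

theory Submission
  imports
    Defs
    "HOL-Library.Poly_Mapping"
    "HOL-Library.Product_Plus"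
    "HOL-Computational_Algebra.Formal_Laurent_Series"
begin

text \<open>
  Let \<open>N\<^sub>n(e\<^sub>1, e\<^sub>2)\<close> be the coefficients of \<open>x\<^sub>n\<close> as a Laurent polynomial. Shifting indices, \<open>x\<^sub>n\<close> is
  the Laurent polynomial of \<open>x\<^sub>n\<^sub>-\<^sub>1\<close> evaluated at \<open>(x\<^sub>2, x\<^sub>3)\<close> with \<open>x\<^sub>3 = (x\<^sub>2\<^sup>c + 1) / x\<^sub>1\<close>. Expanding
  the powers of \<open>x\<^sub>2\<^sup>c + 1\<close> as binomial series expresses \<open>N\<^sub>n(e\<^sub>1, e\<^sub>2)\<close> as a sum over \<open>f\<close> of
  \<open>N\<^sub>n\<^sub>-\<^sub>1(e\<^sub>2, f)\<close> times a generalized binomial coefficient, and iterating this recursion produces the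
  product in the theorem with \<open>f = a\<^sub>n\<^sub>-\<^sub>3 - s\<^sub>n\<^sub>-\<^sub>3\<close>. Two facts account for the range of summation.
  First, in the degree with weights \<open>(a\<^sub>n\<^sub>-\<^sub>1, a\<^sub>n\<^sub>-\<^sub>2)\<close> the variables \<open>x\<^sub>1, x\<^sub>2, x\<^sub>3, \<dots>\<close> have degrees
  \<open>a\<^sub>n\<^sub>-\<^sub>1, a\<^sub>n\<^sub>-\<^sub>2, a\<^sub>n\<^sub>-\<^sub>3, \<dots>, a\<^sub>1 = 0\<close>, so that \<open>x\<^sub>n\<close> has degree at most \<open>-1\<close>; this says that
  \<open>N\<^sub>n(e\<^sub>1, e\<^sub>2) = 0\<close> unless \<open>e\<^sub>2 a\<^sub>n\<^sub>-\<^sub>1 \<ge> e\<^sub>1 a\<^sub>n\<^sub>-\<^sub>2\<close>. Second, when this inequality holds, the terms whose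
  inner binomial coefficient has a negative upper entry are multiplied by an outer one that vanishes.
\<close>

subsection \<open>Laurent polynomials and the Laurent phenomenon\<close>

type_synonym laurent2 = "int \<times> int \<Rightarrow>\<^sub>0 int"

definition laurent_eval :: "'a::field \<Rightarrow> 'a \<Rightarrow> laurent2 \<Rightarrow> 'a" where
  "laurent_eval u v f =
     (\<Sum>(p, q)\<in>Poly_Mapping.keys f. of_int (Poly_Mapping.lookup f (p, q)) * (u powi p * v powi q))"

lemma laurent_eval_superset:
  assumes "finite A" "Poly_Mapping.keys f \<subseteq> A"
  shows "laurent_eval u v f =
    (\<Sum>(p, q)\<in>A. of_int (Poly_Mapping.lookup f (p, q)) * (u powi p * v powi q))"
  unfolding laurent_eval_def using assms
  by (intro sum.mono_neutral_left) (auto simp: in_keys_iff)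

lemma laurent_eval_zero [simp]: "laurent_eval u v 0 = 0"
  by (simp add: laurent_eval_def)

lemma laurent_eval_single:
  "laurent_eval u v (Poly_Mapping.single (p, q) k) = of_int k * (u powi p * v powi q)"
  by (subst laurent_eval_superset[where A = "{(p, q)}"]) auto

lemma laurent_eval_one [simp]: "laurent_eval u v 1 = 1"
  using laurent_eval_single[of u v 0 0 1] by (simp add: zero_prod_def[symmetric])

lemma laurent_eval_add: "laurent_eval u v (f + g) = laurent_eval u v f + laurent_eval u v g"
proof -
  let ?A = "Poly_Mapping.keys f \<union> Poly_Mapping.keys g"
  have *: "finite ?A" by simp
  show ?thesis
    using Poly_Mapping.keys_add[of f g]
    by (simp add: laurent_eval_superset[OF *] lookup_add case_prod_unfold distrib_right
        sum.distrib)
qed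

lemma laurent_eval_uminus: "laurent_eval u v (- f) = - laurent_eval u v f"
  using laurent_eval_add[of u v f "- f"] by (simp add: eq_neg_iff_add_eq_0 add.commute)

lemma laurent_eval_diff: "laurent_eval u v (f - g) = laurent_eval u v f - laurent_eval u v g"
  using laurent_eval_add[of u v f "- g"] by (simp add: laurent_eval_uminus)

lemma laurent_eval_sum: "laurent_eval u v (\<Sum>i\<in>A. f i) = (\<Sum>i\<in>A. laurent_eval u v (f i))"
  by (induction A rule: infinite_finite_induct) (auto simp: laurent_eval_add)

lemma poly_mapping_eq_sum_single:
  "f = (\<Sum>k\<in>Poly_Mapping.keys f. Poly_Mapping.single k (Poly_Mapping.lookup f k))"
  by (rule poly_mapping_eqI)
    (auto simp: lookup_sum lookup_single when_def in_keys_iff)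

lemma laurent_eval_mult:
  assumes "u \<noteq> 0" "v \<noteq> 0"
  shows "laurent_eval u v (f * g) = laurent_eval u v f * laurent_eval u v g"
proof -
  let ?s = "\<lambda>f k. Poly_Mapping.single k (Poly_Mapping.lookup f k) :: laurent2"
  have single: "laurent_eval u v (?s f k * ?s g l) = laurent_eval u v (?s f k) * laurent_eval u v (?s g l)"
    for k l
    using assms by (cases k; cases l)
      (simp add: Poly_Mapping.mult_single laurent_eval_single power_int_add mult_ac)
  have "laurent_eval u v (f * g) = laurent_eval u v
      ((\<Sum>k\<in>Poly_Mapping.keys f. ?s f k) * (\<Sum>l\<in>Poly_Mapping.keys g. ?s g l))"
    by (simp flip: poly_mapping_eq_sum_single)
  also have "\<dots> = laurent_eval u v (\<Sum>k\<in>Poly_Mapping.keys f. ?s f k) *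
      laurent_eval u v (\<Sum>l\<in>Poly_Mapping.keys g. ?s g l)"
    by (simp add: sum_product laurent_eval_sum single)
  finally show ?thesis by (simp flip: poly_mapping_eq_sum_single)
qed

lemma laurent_eval_power:
  "u \<noteq> 0 \<Longrightarrow> v \<noteq> 0 \<Longrightarrow> laurent_eval u v (f ^ k) = laurent_eval u v f ^ k"
  by (induction k) (auto simp: laurent_eval_mult)

text \<open>The quotient \<open>((z ^ c + 1) ^ c - 1) / z\<close> (for \<open>c > 0\<close>) written
  without division, so that it makes sense for Laurent polynomials.\<close>

definition geom_factor :: "nat \<Rightarrow> 'a::comm_ring_1 \<Rightarrow> 'a" where
  "geom_factor c z = z ^ (c - 1) * (\<Sum>i<c. (z ^ c + 1) ^ i)"

lemma geom_factor:
  assumes "c > 0"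
  shows "z * geom_factor c z = (z ^ c + 1) ^ c - 1"
proof -
  have "z * geom_factor c z = z ^ c * (\<Sum>i<c. (z ^ c + 1) ^ i)"
    using assms by (cases c) (simp_all add: geom_factor_def mult.assoc)
  then show ?thesis
    using power_diff_1_eq[of "z ^ c + 1" c] by simp
qed

lemma laurent_eval_geom_factor:
  "u \<noteq> 0 \<Longrightarrow> v \<noteq> 0 \<Longrightarrow> laurent_eval u v (geom_factor c f) = geom_factor c (laurent_eval u v f)"
  by (simp add: geom_factor_def laurent_eval_mult laurent_eval_power laurent_eval_sum
      laurent_eval_add)

text \<open>Multiplying \<open>y\<^sub>k\<^sub>+\<^sub>4\<close> by \<open>y\<^sub>k y\<^sub>k\<^sub>+\<^sub>2 = y\<^sub>k\<^sub>+\<^sub>1\<^sup>c + 1\<close> eliminates every denominator.\<close>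

lemma exchange_four_terms:
  fixes y :: "nat \<Rightarrow> 'a::field"
  assumes "c > 0" "y (k + 2) \<noteq> 0"
    and "y k * y (k + 2) = y (k + 1) ^ c + 1"
    and "y (k + 1) * y (k + 3) = y (k + 2) ^ c + 1"
    and "y (k + 2) * y (k + 4) = y (k + 3) ^ c + 1"
  shows "y (k + 4) = y k * y (k + 3) ^ c - geom_factor c (y (k + 2))"
proof -
  let ?p = "geom_factor c (y (k + 2))"
  have "y (k + 2) * (y (k + 4) * y (k + 1) ^ c) = (y (k + 3) ^ c + 1) * y (k + 1) ^ c"
    by (simp only: assms(5)[symmetric] mult.assoc)
  also have "\<dots> = (y (k + 1) * y (k + 3)) ^ c + y (k + 1) ^ c"
    by (simp add: power_mult_distrib algebra_simps)
  also have "\<dots> = y (k + 2) * (?p + y k)"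
    using geom_factor[OF assms(1), of "y (k + 2)"] assms(3) unfolding assms(4)
    by (simp add: algebra_simps)
  finally have "y (k + 4) * y (k + 1) ^ c = ?p + y k"
    using assms(2) by simp
  moreover have "y k * (y (k + 3) ^ c + 1) = y (k + 4) * (y (k + 1) ^ c + 1)"
    unfolding assms(3,5)[symmetric] by (simp add: mult_ac)
  ultimately show ?thesis by (simp add: algebra_simps)
qed

text \<open>The division-free four-term recursion runs inside the ring of Laurent polynomials with
  integer coefficients, which gives the Laurent phenomenon. It reaches back four indices, hence four
  starting values, x_0 included.\<close>

fun cluster_laurent :: "nat \<Rightarrow> nat \<Rightarrow> laurent2" where
  "cluster_laurent c 0 = Poly_Mapping.single (int c, -1) 1 + Poly_Mapping.single (0, -1) 1"
| "cluster_laurent c (Suc 0) = Poly_Mapping.single (1, 0) 1"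
| "cluster_laurent c (Suc (Suc 0)) = Poly_Mapping.single (0, 1) 1"
| "cluster_laurent c (Suc (Suc (Suc 0))) =
     Poly_Mapping.single (-1, int c) 1 + Poly_Mapping.single (-1, 0) 1"
| "cluster_laurent c (Suc (Suc (Suc (Suc n)))) =
     cluster_laurent c n * cluster_laurent c (Suc (Suc (Suc n))) ^ c
     - geom_factor c (cluster_laurent c (Suc (Suc n)))"

text \<open>Stated for any solution \<open>y\<close> in any field, so that it also applies to
  shifted sequences. Beyond \<open>y 1\<close> and \<open>y 2\<close>, nonvanishing is demanded only
  up to index \<open>n - 2\<close>, which allows its use in an induction proving \<open>y n\<close>
  nonzero.\<close>

lemma laurent_eval_cluster_laurent:
  fixes y :: "nat \<Rightarrow> 'a::field"
  assumes "c > 0" "y 1 \<noteq> 0" "y 2 \<noteq> 0" "n \<ge> 2"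
    and "\<And>k. k + 2 \<le> n \<Longrightarrow> y k * y (k + 2) = y (k + 1) ^ c + 1"
    and "\<And>k. 1 \<le> k \<Longrightarrow> k + 2 \<le> n \<Longrightarrow> y k \<noteq> 0"
  shows "laurent_eval (y 1) (y 2) (cluster_laurent c n) = y n"
proof -
  have "laurent_eval (y 1) (y 2) (cluster_laurent c j) = y j" if "j \<le> n" for j
    using that
  proof (induction j rule: less_induct)
    case (less j)
    consider "j = 0" | "j = 1" | "j = 2" | "j = 3" | k where "j = k + 4"
      by atomize_elim presburger
    then show ?case
    proof cases
      case 1
      have "y 0 * y 2 = y 1 ^ c + 1"
        using assms(4) assms(5)[of 0] by (simp add: numeral_2_eq_2)
      then show ?thesis using 1 assms(3)
        by (simp add: laurent_eval_add laurent_eval_single field_simps)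
    next
      case 2
      then show ?thesis by (simp add: laurent_eval_single)
    next
      case 3
      then show ?thesis by (simp add: laurent_eval_single numeral_2_eq_2)
    next
      case 4
      then have "y 1 * y 3 = y 2 ^ c + 1"
        using assms(5)[of 1] less.prems by (simp add: numeral_eq_Suc)
      then show ?thesis using 4 assms(2)
        by (simp add: numeral_3_eq_3 laurent_eval_add laurent_eval_single field_simps)
    next
      case 5
      have IH: "laurent_eval (y 1) (y 2) (cluster_laurent c i) = y i" if "i < j" for i
        using less that by simp
      have "y (k + 4) = y k * y (k + 3) ^ c - geom_factor c (y (k + 2))"
        using less.prems assms(5)[of k] assms(5)[of "k + 1"] assms(5)[of "k + 2"]
          assms(6)[of "k + 2"] 5
        by (intro exchange_four_terms assms(1)) (simp_all add: numeral_eq_Suc)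
      then show ?thesis
        using IH[of k] IH[of "k + 2"] IH[of "k + 3"] 5 assms(2,3)
        by (simp add: numeral_eq_Suc laurent_eval_diff laurent_eval_mult laurent_eval_power
            laurent_eval_geom_factor)
    qed
  qed
  then show ?thesis by simp
qed

subsection \<open>Coefficient extraction in iterated Laurent series\<close>

text \<open>With S the inner and T the outer variable, the monomial \<open>(p, q)\<close> becomes
  \<open>S^p T^(w1 p + w2 q)\<close>, and \<open>w2 \<noteq> 0\<close> keeps distinct monomials
  apart. Weights 0 and 1 extract coefficients; other weights make the outer order a weighted
  degree.\<close>

lemma fls_nth_laurent_eval_monomials:
  fixes f :: laurent2 and w1 w2 :: int
  assumes "w2 \<noteq> 0"
  shows "fls_nth (fls_nth (laurent_eval (fls_const fls_X * fls_X powi w1) (fls_X powi w2) f)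
      (w1 * p + w2 * q)) p = (of_int (Poly_Mapping.lookup f (p, q)) :: rat)"
proof -
  define u :: "rat fls fls" where "u = fls_const fls_X * fls_X powi w1"
  define v :: "rat fls fls" where "v = fls_X powi w2"
  have X: "fls_X_intpow w powi r = (fls_X_intpow (w * r) :: rat fls fls)" for w r
    by (simp only: power_int_mult flip: fls_X_power_int)
  have mono: "u powi p' * v powi q' = fls_const (fls_X_intpow p') * fls_X_intpow (w1 * p' + w2 * q')"
    for p' q'
    by (simp only: u_def v_def power_int_mult_distrib X mult.assoc fls_X_power_int
        fls_X_intpow_times_fls_X_intpow flip: fls_const_power_int)
  have nth_term: "fls_nth (fls_nth (of_int k * (u powi p' * v powi q')) (w1 * p + w2 * q)) p =
      (if (p', q') = (p, q) then of_int k else 0)" for k p' q'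
    using assms unfolding mono by (auto simp: fls_of_int mult.assoc)
  have "fls_nth (fls_nth (laurent_eval u v f) (w1 * p + w2 * q)) p =
      (\<Sum>k\<in>Poly_Mapping.keys f. if k = (p, q) then of_int (Poly_Mapping.lookup f k) else 0)"
    unfolding laurent_eval_def fls_nth_sum
    by (rule sum.cong[OF refl]) (simp only: case_prod_unfold nth_term prod.collapse)
  also have "\<dots> = of_int (Poly_Mapping.lookup f (p, q))"
    by (simp add: in_keys_iff)
  finally show ?thesis unfolding u_def v_def .
qed

text \<open>The coefficient of \<open>z^k\<close> in \<open>(1 + z)^A\<close>, for \<open>A\<close>
  of either sign.\<close>

definition gbinom_int :: "int \<Rightarrow> int \<Rightarrow> rat" where
  "gbinom_int A k = (if k < 0 then 0 else of_int A gchoose nat k)"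

lemma gbinom_int_neg: "k < 0 \<Longrightarrow> gbinom_int A k = 0"
  by (simp add: gbinom_int_def)

lemma gbinom_int_gt:
  assumes "0 \<le> A" "A < k" shows "gbinom_int A k = 0"
proof -
  have "(of_int A :: rat) gchoose nat k = of_nat (nat A choose nat k)"
    using assms by (simp add: binomial_gbinomial)
  then show ?thesis using assms by (simp add: gbinom_int_def binomial_eq_0)
qed

lemma gbinom_int_pascal: "gbinom_int (A + 1) k = gbinom_int A k + gbinom_int A (k - 1)"
proof (cases "k \<le> 0")
  case False
  then obtain j where "k = int (Suc j)"
    by (metis not_le zero_less_imp_eq_int Suc_pred)
  then show ?thesis
    using gbinomial_Suc_Suc[of "of_int A :: rat" j]
    by (simp add: gbinom_int_def nat_add_distrib)
qed (auto simp: gbinom_int_def)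

lemma gbinom_int_0: "gbinom_int 0 k = (if k = 0 then 1 else 0)"
  by (auto simp: gbinom_int_def gbinomial_0_left)

text \<open>With \<open>k = A - B\<close> the product is the falling factorial of \<open>A\<close>
  of length \<open>k\<close> over \<open>k!\<close>, so \<open>B\<close> plays the complementary
  role.\<close>

lemma mbinom_eq_gbinom_int: "mbinom A B = gbinom_int A (A - B)"
proof (cases "A > B")
  case True
  define k where "k = nat (A - B)"
  have k: "A - B = int k" using True by (simp add: k_def)
  have "mbinom A B = (\<Prod>i\<in>{0..int k - 1}. of_int (A - i) / of_int (int k - i))"
    using True k by (simp add: mbinom_def)
  also have "\<dots> = (\<Prod>i\<in>{0..<k}. of_int (A - int i) / of_int (int k - int i))"
    by (rule prod.reindex_bij_witness[where i = int and j = nat]) auto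
  also have "\<dots> = (\<Prod>i\<in>{0..<k}. (of_int A - of_nat i) / of_nat (k - i))"
    by (rule prod.cong) (auto simp: of_nat_diff)
  finally show ?thesis
    using True by (simp add: gbinomial_altdef_of_nat gbinom_int_def k_def)
qed (auto simp: mbinom_def gbinom_int_def)

text \<open>By Pascal's rule the binomial series \<open>G q\<close> satisfy
  \<open>G (q + 1) = (X^c + 1) * G q\<close> for all integers \<open>q\<close>; with
  \<open>G 0 = 1\<close> this determines them in both directions.\<close>

lemma fls_nth_one_plus_X_power_powi:
  fixes c :: nat and q j :: int
  assumes "c > 0"
  shows "fls_nth ((fls_X ^ c + 1 :: 'a::field_char_0 fls) powi q) j =
    (if int c dvd j then of_rat (gbinom_int q (j div int c)) else 0)"
proof -
  define g :: "int \<Rightarrow> int \<Rightarrow> 'a" where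
    "g q j = (if int c dvd j then of_rat (gbinom_int q (j div int c)) else 0)" for q j
  define G where "G q = Abs_fls (g q)" for q
  have "g q j = 0" if "j < 0" for q j
  proof (cases "int c dvd j")
    case True
    then have "j div int c < 0" using assms that by (auto elim!: dvdE simp: mult_less_0_iff)
    then show ?thesis by (simp add: g_def gbinom_int_neg)
  qed (simp add: g_def)
  then have nth: "fls_nth (G q) j = g q j" for q j
    unfolding G_def by (subst nth_Abs_fls_lower_bound[of 0]) auto
  have step: "G (q + 1) = (fls_X ^ c + 1) * G q" for q
  proof (rule fls_eqI)
    fix j
    have "(j - int c) div int c = j div int c - 1"
      using assms div_mult_self1[of "int c" j "-1"] by simp
    moreover have "int c dvd j - int c \<longleftrightarrow> int c dvd j"
      by (metis dvd_diff_left_iff dvd_refl)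
    ultimately show "fls_nth (G (q + 1)) j = fls_nth ((fls_X ^ c + 1) * G q) j"
      by (auto simp: nth g_def distrib_right fls_X_power_times_conv_shift gbinom_int_pascal
          of_rat_add)
  qed
  have G0: "G 0 = 1"
    by (rule fls_eqI) (use assms in \<open>auto simp: nth g_def gbinom_int_0 elim!: dvdE\<close>)
  \<comment> \<open>At \<open>q = -1\<close> the step exhibits an inverse of
    \<open>X^c + 1\<close>.\<close>
  have nz: "fls_X ^ c + 1 \<noteq> (0 :: 'a fls)"
    using step[of "-1"] G0 by auto
  have "G q = (fls_X ^ c + 1) powi q"
  proof (induction q rule: int_induct[where k = 0])
    case base
    then show ?case by (simp add: G0)
  next
    case (step1 i)
    then show ?case using nz by (simp add: step power_int_add mult.commute)
  next
    case (step2 i)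
    have "(fls_X ^ c + 1) * G (i - 1) = (fls_X ^ c + 1) * (fls_X ^ c + 1) powi (i - 1)"
      using step[of "i - 1"] step2 nz by (simp add: power_int_diff)
    then show ?case using nz by simp
  qed
  then show ?thesis using nth[of q j] by (simp add: g_def)
qed

section \<open>Solutions of the exchange recursion in a field, and the recursion for Laurent
  coefficients\<close>

fun exch_seq :: "nat \<Rightarrow> 'a::field \<Rightarrow> 'a \<Rightarrow> nat \<Rightarrow> 'a" where
  "exch_seq c u v 0 = (u ^ c + 1) / v"
| "exch_seq c u v (Suc 0) = u"
| "exch_seq c u v (Suc (Suc 0)) = v"
| "exch_seq c u v (Suc (Suc (Suc n))) =
     (exch_seq c u v (Suc (Suc n)) ^ c + 1) / exch_seq c u v (Suc n)"

lemma exch_seq_2 [simp]: "exch_seq c u v 2 = v"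
  by (simp add: numeral_2_eq_2)

lemma exch_seq_exchange:
  assumes "v \<noteq> 0" "k \<ge> 1 \<Longrightarrow> exch_seq c u v k \<noteq> 0"
  shows "exch_seq c u v k * exch_seq c u v (k + 2) = exch_seq c u v (k + 1) ^ c + 1"
  using assms by (cases k) auto

lemma laurent_eval_exch_seq:
  assumes "c > 0" "u \<noteq> 0" "v \<noteq> 0" "n \<ge> 2"
    and "\<And>k. 1 \<le> k \<Longrightarrow> k + 2 \<le> n \<Longrightarrow> exch_seq c u v k \<noteq> 0"
  shows "laurent_eval u v (cluster_laurent c n) = exch_seq c u v n"
  using laurent_eval_cluster_laurent[of c "exch_seq c u v" n] assms exch_seq_exchange[of v _ c u]
  by simp

lemma exch_seq_pos: "exch_seq c 1 1 n > (0 :: rat)"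
  by (induction c "1 :: rat" "1 :: rat" n rule: exch_seq.induct)
    (auto intro!: divide_pos_pos add_pos_pos)

text \<open>Evaluating at \<open>(1, 1)\<close> gives a sequence of positive rationals.\<close>

lemma cluster_laurent_nonzero:
  assumes "c > 0" "n \<ge> 2"
  shows "cluster_laurent c n \<noteq> 0"
proof
  assume "cluster_laurent c n = 0"
  moreover have "exch_seq c 1 1 k \<noteq> (0 :: rat)" for k
    using exch_seq_pos[of c k] by simp
  ultimately show False
    using laurent_eval_exch_seq[of c "1 :: rat" 1 n] assms exch_seq_pos[of c n] by simp
qed

text \<open>The value is a nonzero Laurent polynomial at two independent variables. The evaluation
  at index \<open>n\<close> needs nonvanishing only up to \<open>n - 2\<close>, which the induction
  supplies.\<close>

lemma exch_seq_generic_nonzero: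
  assumes "c > 0" "n \<ge> 1"
  shows "exch_seq c (fls_const fls_X) fls_X n \<noteq> (0 :: rat fls fls)"
  using assms(2)
proof (induction n rule: less_induct)
  case (less n)
  show ?case
  proof (cases "n = 1")
    case False
    then have n: "n \<ge> 2" using less.prems by simp
    obtain p q where "Poly_Mapping.lookup (cluster_laurent c n) (p, q) \<noteq> 0"
      using cluster_laurent_nonzero[OF assms(1) n]
      by (metis lookup_zero poly_mapping_eqI surj_pair)
    then have "laurent_eval (fls_const fls_X) fls_X (cluster_laurent c n) \<noteq> (0 :: rat fls fls)"
      using fls_nth_laurent_eval_monomials[of 1 0 "cluster_laurent c n" p q]
      by auto
    moreover have "laurent_eval (fls_const fls_X) fls_X (cluster_laurent c n) =
        exch_seq c (fls_const fls_X) (fls_X :: rat fls fls) n"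
      using less n assms(1) by (intro laurent_eval_exch_seq) auto
    ultimately show ?thesis by simp
  qed simp
qed

lemma of_rat_fls: "(of_rat r :: 'a::field_char_0 fls) = fls_const (of_rat r)"
  by (cases r) (simp add: of_rat_rat fls_of_int fls_const_divide_const)

text \<open>Compares coefficients of \<open>S^p' T^q'\<close> in two expansions of one element. In
  the second, a monomial contributes \<open>S^(-q) T^p (T^c + 1)^q\<close>, whence both conditions
  in the sum.\<close>

lemma lookup_cluster_laurent_Suc:
  assumes "c > 0" "n \<ge> 2"
  shows "of_int (Poly_Mapping.lookup (cluster_laurent c (Suc n)) (p', q')) =
    (\<Sum>(p, q)\<in>Poly_Mapping.keys (cluster_laurent c n). if q = - p' \<and> int c dvd q' - p
       then of_int (Poly_Mapping.lookup (cluster_laurent c n) (p, q))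
         * gbinom_int q ((q' - p) div int c) else 0)"
proof -
  define S T where "S = (fls_const fls_X :: rat fls fls)" and "T = (fls_X :: rat fls fls)"
  define y where "y = exch_seq c S T"
  have nz: "y k \<noteq> 0" if "k \<ge> 1" for k
    unfolding y_def S_def T_def using exch_seq_generic_nonzero that assms(1) by blast
  have ST: "S \<noteq> 0" "T \<noteq> 0" by (simp_all add: S_def T_def)
  have ex: "y k * y (k + 2) = y (k + 1) ^ c + 1" for k
    using nz exch_seq_exchange[of T k c S] ST by (auto simp: y_def)
  have y3: "y 3 = (T ^ c + 1) / S" by (simp add: y_def numeral_3_eq_3)
  have "laurent_eval S T (cluster_laurent c (Suc n)) = y (Suc n)"
    using laurent_eval_exch_seq[of c S T "Suc n"] ST assms nz unfolding y_def by auto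
  \<comment> \<open>The shifted sequence \<open>y (Suc k)\<close> solves the same exchange
    relations, starting from \<open>T\<close> and \<open>y 3\<close>.\<close>
  also have "\<dots> = laurent_eval T (y 3) (cluster_laurent c n)"
    using laurent_eval_cluster_laurent[of c "\<lambda>k. y (Suc k)" n] assms ST nz nz[of 3] ex[of "Suc _"]
    by (simp add: y_def numeral_3_eq_3 numeral_2_eq_2)
  finally have eq: "laurent_eval S T (cluster_laurent c (Suc n)) =
      laurent_eval T ((T ^ c + 1) / S) (cluster_laurent c n)"
    by (simp add: y3)
  have mono: "T powi p * ((T ^ c + 1) / S) powi q =
      fls_const (fls_X_intpow (- q)) * (fls_X_intpow p * (T ^ c + 1) powi q)" for p q
  proof -
    have "S powi (- q) = fls_const (fls_X_intpow (- q))"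
      by (simp add: S_def flip: fls_const_power_int)
    moreover have "((T ^ c + 1) / S) powi q = (T ^ c + 1) powi q * S powi (- q)"
      by (simp add: power_int_divide_distrib power_int_minus field_simps)
    ultimately show ?thesis by (simp add: T_def mult_ac)
  qed
  have nth_term: "fls_nth (fls_nth (of_int k * (T powi p * ((T ^ c + 1) / S) powi q)) q') p' =
      (if q = - p' \<and> int c dvd q' - p then of_int k * gbinom_int q ((q' - p) div int c) else 0)"
    for k p q
    unfolding mono
    by (simp add: fls_of_int fls_X_intpow_times_conv_shift T_def assms(1)
        fls_nth_one_plus_X_power_powi of_rat_fls)
  have "of_int (Poly_Mapping.lookup (cluster_laurent c (Suc n)) (p', q')) =
      fls_nth (fls_nth (laurent_eval T ((T ^ c + 1) / S) (cluster_laurent c n)) q') p'"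
    using fls_nth_laurent_eval_monomials[of 1 0 "cluster_laurent c (Suc n)" p' q']
    unfolding eq[symmetric] by (simp add: S_def T_def)
  then show ?thesis
    by (simp only: laurent_eval_def fls_nth_sum case_prod_unfold nth_term)
qed

subsection \<open>The support of a cluster variable\<close>

text \<open>For \<open>c \<ge> 2\<close> and a nonnegative term, the next increment is at least the
  previous one; the two claims feed each other in the induction.\<close>

lemma a_seq_mono_nonneg:
  assumes "c \<ge> 2"
  shows "a_seq c k < a_seq c (Suc k) \<and> 0 \<le> a_seq c (Suc k)"
proof (induction k)
  case (Suc k)
  have "2 * a_seq c (Suc k) \<le> int c * a_seq c (Suc k)"
    using Suc assms by (intro mult_right_mono) auto
  then show ?case using Suc by simp
qed simp

lemma a_seq_nonneg: "c \<ge> 2 \<Longrightarrow> k \<ge> 1 \<Longrightarrow> 0 \<le> a_seq c k"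
  using a_seq_mono_nonneg[of c "k - 1"] by simp

lemma a_seq_pos:
  assumes "c \<ge> 2" "k \<ge> 2"
  shows "0 < a_seq c k"
proof -
  obtain j where "k = Suc (Suc j)"
    using assms(2) by (metis add_2_eq_Suc le_Suc_ex)
  then show ?thesis
    using a_seq_mono_nonneg[OF assms(1), of j] a_seq_mono_nonneg[OF assms(1), of "Suc j"]
    by (simp only:) linarith
qed

text \<open>The determinant of two solutions of the recurrence does not change with
  \<open>k\<close>; at \<open>k = 0\<close> it is read off from \<open>a_0 = -1\<close> and
  \<open>a_1 = 0\<close>.\<close>

lemma a_seq_dOcagne:
  "a_seq c (d + k) * a_seq c (Suc k) - a_seq c k * a_seq c (Suc (d + k)) = a_seq c (Suc d)"
  by (induction k) (simp_all add: algebra_simps)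

lemma a_seq_Cassini: "a_seq c k * a_seq c (k + 2) = (a_seq c (k + 1))\<^sup>2 - 1"
  using a_seq_dOcagne[of c 1 k] by (simp add: power2_eq_square)

text \<open>The coefficient indexed by \<open>(e\<^sub>1, e\<^sub>2)\<close> in the theorem for \<open>n = m + 3\<close>; the exponent of \<open>x\<^sub>1\<close>
  is \<open>- a\<^sub>n\<^sub>-\<^sub>1 + c (a\<^sub>n\<^sub>-\<^sub>2 - e\<^sub>2) = a\<^sub>m - c e\<^sub>2\<close>.\<close>

definition laurent_coeff :: "nat \<Rightarrow> nat \<Rightarrow> int \<Rightarrow> int \<Rightarrow> int" where
  "laurent_coeff c m e1 e2 = Poly_Mapping.lookup (cluster_laurent c (m + 3))
     (a_seq c m - int c * e2, int c * e1 - a_seq c (m + 1))"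

lemma laurent_coeff_0:
  assumes "c > 0"
  shows "laurent_coeff c 0 e1 e2 = (if e2 = 0 \<and> (e1 = 0 \<or> e1 = 1) then 1 else 0)"
  using assms
  by (auto simp: laurent_coeff_def numeral_3_eq_3 lookup_add lookup_single when_def)

text \<open>Ensures that \<open>laurent_coeff\<close> captures every coefficient. A key
  \<open>(p, q)\<close> at the next index comes from a key \<open>(p', -p)\<close> with
  \<open>c\<close> dividing \<open>q - p'\<close>, and the recurrence of \<open>a_seq\<close> closes
  the induction.\<close>

lemma keys_cluster_laurent:
  assumes "c > 0" "(p, q) \<in> Poly_Mapping.keys (cluster_laurent c (m + 3))"
  shows "int c dvd a_seq c m - p" "int c dvd q + a_seq c (m + 1)"
proof -
  have "int c dvd a_seq c m - p \<and> int c dvd q + a_seq c (m + 1)"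
    using assms(2)
  proof (induction m arbitrary: p q)
    case 0
    then show ?case
      by (auto simp: numeral_3_eq_3 in_keys_iff lookup_add lookup_single when_def split: if_splits)
  next
    case (Suc m)
    have "\<exists>p'. (p', - p) \<in> Poly_Mapping.keys (cluster_laurent c (m + 3)) \<and> int c dvd q - p'"
    proof (rule ccontr)
      assume "\<not> ?thesis"
      then have "of_int (Poly_Mapping.lookup (cluster_laurent c (Suc (m + 3))) (p, q)) = (0 :: rat)"
        by (subst lookup_cluster_laurent_Suc[OF assms(1)]) (auto intro!: sum.neutral)
      then show False using Suc.prems by (simp add: in_keys_iff)
    qed
    then obtain p' where p': "(p', - p) \<in> Poly_Mapping.keys (cluster_laurent c (m + 3))"
      and q: "int c dvd q - p'"
      by blast
    from Suc.IH[OF p'] have "int c dvd a_seq c m - p'" "int c dvd a_seq c (m + 1) - p"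
      by simp_all
    moreover from this(1) q have "int c dvd (q - p') - (a_seq c m - p') + int c * a_seq c (m + 1)"
      by (metis dvd_add dvd_diff dvd_triv_left)
    ultimately show ?case by (simp add: algebra_simps)
  qed
  then show "int c dvd a_seq c m - p" "int c dvd q + a_seq c (m + 1)" by auto
qed

lemma finite_laurent_coeff:
  assumes "c > 0"
  shows "finite {(e1, e2). laurent_coeff c m e1 e2 \<noteq> 0}"
proof (rule finite_imageD)
  let ?h = "\<lambda>(e1, e2). (a_seq c m - int c * e2, int c * e1 - a_seq c (m + 1))"
  show "finite (?h ` {(e1, e2). laurent_coeff c m e1 e2 \<noteq> 0})"
    by (rule finite_subset[OF _ finite_keys[of "cluster_laurent c (m + 3)"]])
      (auto simp: laurent_coeff_def in_keys_iff)
  show "inj_on ?h {(e1, e2). laurent_coeff c m e1 e2 \<noteq> 0}"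
    using assms by (auto simp: inj_on_def)
qed

text \<open>The second exponent of \<open>(e2, f)\<close> at index \<open>m\<close> is minus the
  first exponent of \<open>(e1, e2)\<close> at index \<open>m + 1\<close>. \<open>J\<close> is left
  free so that the sum over tuples can share it.\<close>

lemma laurent_coeff_Suc:
  assumes c: "c > 0" and J: "finite J" "{f. laurent_coeff c m e2 f \<noteq> 0} \<subseteq> J"
  shows "of_int (laurent_coeff c (Suc m) e1 e2) =
    (\<Sum>f\<in>J. of_int (laurent_coeff c m e2 f)
       * gbinom_int (int c * e2 - a_seq c (m + 1)) (e1 - a_seq c (m + 1) + f))"
proof -
  let ?F = "cluster_laurent c (m + 3)" and ?K = "Poly_Mapping.keys (cluster_laurent c (m + 3))"
  let ?p' = "a_seq c (m + 1) - int c * e2" and ?q' = "int c * e1 - a_seq c (m + 2)"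
  let ?h = "\<lambda>f. (a_seq c m - int c * f, - ?p')"
  define g where "g = (\<lambda>(p, q). if q = - ?p' \<and> int c dvd ?q' - p
       then of_int (Poly_Mapping.lookup ?F (p, q)) * gbinom_int q ((?q' - p) div int c) else 0)"
  have inj: "inj_on ?h J" using c by (auto simp: inj_on_def)
  have "of_int (laurent_coeff c (Suc m) e1 e2) = sum g ?K"
    using lookup_cluster_laurent_Suc[OF c, of "m + 3" ?p' ?q']
    by (simp add: laurent_coeff_def g_def)
  also have "\<dots> = sum g (?h ` J)"
  proof (rule sum.mono_neutral_cong)
    show "g i = 0" if "i \<in> ?h ` J - ?K" for i
      using that by (auto simp: g_def in_keys_iff)
    show "g i = 0" if "i \<in> ?K - ?h ` J" for i
    proof (rule ccontr)
      assume "g i \<noteq> 0"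
      then obtain p where i: "i = (p, - ?p')" by (cases i) (auto simp: g_def split: if_splits)
      have "int c dvd a_seq c m - p"
        using keys_cluster_laurent(1)[OF c] that i by blast
      then obtain f where "a_seq c m - p = int c * f" by (rule dvdE)
      then have p: "p = a_seq c m - int c * f" by simp
      then have "laurent_coeff c m e2 f \<noteq> 0"
        using i that by (simp add: laurent_coeff_def in_keys_iff)
      then show False using i p that J(2) by auto
    qed
  qed (use J in auto)
  also have "\<dots> = (\<Sum>f\<in>J. g (?h f))"
    using inj by (subst sum.reindex) auto
  also have "\<dots> = (\<Sum>f\<in>J. of_int (laurent_coeff c m e2 f)
       * gbinom_int (int c * e2 - a_seq c (m + 1)) (e1 - a_seq c (m + 1) + f))"
  proof (rule sum.cong)
    fix f
    have "?q' - (a_seq c m - int c * f) = int c * (e1 - a_seq c (m + 1) + f)"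
      by (simp add: algebra_simps)
    then show "g (?h f) = of_int (laurent_coeff c m e2 f)
       * gbinom_int (int c * e2 - a_seq c (m + 1)) (e1 - a_seq c (m + 1) + f)"
      using c by (simp add: g_def laurent_coeff_def)
  qed simp
  finally show ?thesis .
qed

text \<open>The weights enter negated, so degree is minus subdegree. While the preceding entry has
  positive degree, its power dominates the summand 1 and degrees follow the recurrence of
  \<open>a_seq\<close> backwards. This stops at \<open>k = n\<close>, where the preceding degree is
  \<open>a_1 = 0\<close>.\<close>

lemma exch_seq_weighted_subdegree:
  fixes n :: nat
  assumes "c \<ge> 2" "n \<ge> 4"
  defines "y \<equiv> exch_seq c (fls_const fls_X * fls_X powi (- a_seq c (n - 1)))
    (fls_X powi (- a_seq c (n - 2)) :: rat fls fls)"
  assumes "1 \<le> k" "k < n"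
  shows "y k \<noteq> 0 \<and> fls_subdegree (y k) = - a_seq c (n - k)"
  using assms(4,5)
proof (induction k rule: less_induct)
  case (less k)
  consider "k = 1" | "k = 2" | j where "k = j + 3"
    using less.prems by atomize_elim presburger
  then show ?case
  proof cases
    case 3
    have 1: "y (j + 1) \<noteq> 0" "fls_subdegree (y (j + 1)) = - a_seq c (n - (j + 1))"
      and 2: "y (j + 2) \<noteq> 0" "fls_subdegree (y (j + 2)) = - a_seq c (n - (j + 2))"
      using less.IH[of "j + 1"] less.IH[of "j + 2"] less.prems 3 by auto
    have pow: "fls_subdegree (y (j + 2) ^ c) = - int c * a_seq c (n - (j + 2))"
      by (simp only: fls_subdegree_pow 2)
    have "int c * a_seq c (n - (j + 2)) > 0"
      using assms(1) less.prems 3 a_seq_pos[of c "n - (j + 2)"] by simp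
    with pow have "fls_subdegree (y (j + 2) ^ c + 1) = - int c * a_seq c (n - (j + 2))"
      using 2 by (subst fls_subdegree_add_eq1) auto
    moreover from this \<open>int c * a_seq c (n - (j + 2)) > 0\<close> have nz: "y (j + 2) ^ c + 1 \<noteq> 0"
      by auto
    moreover have yk: "y k = (y (j + 2) ^ c + 1) / y (j + 1)"
      using 3 by (simp add: y_def numeral_3_eq_3)
    moreover have "n - (j + 1) = Suc (Suc (n - k))" "n - (j + 2) = Suc (n - k)"
      using 3 less.prems by auto
    then have "a_seq c (n - (j + 1)) = int c * a_seq c (n - (j + 2)) - a_seq c (n - k)"
      by (simp only: a_seq.simps)
    ultimately show ?thesis using 1
      by (simp add: fls_divide_subdegree)
  qed (auto simp: y_def numeral_2_eq_2 simp del: fls_X_power_int)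
qed

text \<open>The product \<open>y (n - 2) * y n = y (n - 1) ^ c + 1\<close> has degree at most 0 and
  \<open>y (n - 2)\<close> has degree \<open>a_2 = 1\<close>, so \<open>y n\<close> has only
  monomials of negative degree. For \<open>m = 0\<close> the weight \<open>w2\<close> would be 0, so
  that case is direct.\<close>

lemma laurent_coeff_eq_0:
  assumes c: "c \<ge> 2" and e: "e2 * a_seq c (m + 2) < e1 * a_seq c (m + 1)"
  shows "laurent_coeff c m e1 e2 = 0"
proof (cases "m = 0")
  case True
  then show ?thesis using e c by (auto simp: laurent_coeff_0 a_seq_2)
next
  case False
  define n where "n = m + 3"
  define w1 w2 where "w1 = - a_seq c (n - 1)" and "w2 = - a_seq c (n - 2)"
  define u v :: "rat fls fls" where "u = fls_const fls_X * fls_X powi w1" and "v = fls_X powi w2"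
  define y where "y = exch_seq c u v"
  have n: "n \<ge> 4" using False by (simp add: n_def)
  have "2 \<le> n - 2" using n by linarith
  then have w2: "w2 \<noteq> 0" using a_seq_pos[OF c, of "n - 2"] by (simp add: w2_def)
  have y: "y k \<noteq> 0" "fls_subdegree (y k) = - a_seq c (n - k)" if "1 \<le> k" "k < n" for k
    using exch_seq_weighted_subdegree[OF c n that] unfolding y_def u_def v_def w1_def w2_def
    by auto
  have uv: "u \<noteq> 0" "v \<noteq> 0" by (simp_all add: u_def v_def)
  have eval: "laurent_eval u v (cluster_laurent c n) = y n"
    using uv c n y unfolding y_def by (intro laurent_eval_exch_seq) auto
  have "y (n - 2) * y n = y (n - 1) ^ c + 1"
    using exch_seq_exchange[of v "n - 2" c u] uv y(1)[of "n - 2"] n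
    by (simp add: y_def numeral_2_eq_2 Suc_diff_Suc)
  moreover have "fls_nth (y (n - 1) ^ c + 1) k = 0" if "k < 0" for k
    using that y[of "n - 1"] n by (simp add: fls_subdegree_pow)
  ultimately have "0 \<le> fls_subdegree (y (n - 2) * y n)" if "y n \<noteq> 0"
    using that y(1)[of "n - 2"] n by (intro fls_subdegree_geI) auto
  moreover have "fls_subdegree (y (n - 2)) = - 1"
    using y(2)[of "n - 2"] n a_seq_2[of c] by simp
  ultimately have "fls_subdegree (y n) > 0" if "y n \<noteq> 0"
    using that y(1)[of "n - 2"] n by simp
  then have low: "fls_nth (y n) k = 0" if "k \<le> 0" for k
    using that by (cases "y n = 0") auto
  define p q where "p = a_seq c m - int c * e2" and "q = int c * e1 - a_seq c (m + 1)"
  \<comment> \<open>A strict inequality of integers leaves a gap of at least 1, which offsets the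
    value 1 that Cassini's identity gives for the rest of the weight.\<close>
  have "int c * (e1 * a_seq c (m + 1) - e2 * a_seq c (m + 2)) \<ge> 1 * 1"
    using c e by (intro mult_mono) auto
  moreover have "w1 * p + w2 * q = (a_seq c (m + 1))\<^sup>2 - a_seq c m * a_seq c (m + 2)
      - int c * (e1 * a_seq c (m + 1) - e2 * a_seq c (m + 2))"
    by (simp add: w1_def w2_def p_def q_def n_def power2_eq_square algebra_simps del: a_seq.simps)
  ultimately have "w1 * p + w2 * q \<le> 0"
    using a_seq_Cassini[of c m] by simp
  then have "of_int (Poly_Mapping.lookup (cluster_laurent c n) (p, q)) = (0 :: rat)"
    using fls_nth_laurent_eval_monomials[OF w2, of w1 "cluster_laurent c n" p q] low eval
    by (simp add: u_def v_def)
  then show ?thesis by (simp add: laurent_coeff_def n_def p_def q_def)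
qed

subsection \<open>The sum over the variables \<open>t\<^sub>i\<close>\<close>

lemma s_seq_fun_upd: "i \<le> m \<Longrightarrow> s_seq c (t(m := v)) i = s_seq c t i"
  by (auto simp: s_seq_def)

text \<open>A convolution with \<open>a_seq\<close> inherits its recurrence, with \<open>t i\<close>
  as inhomogeneous term. At \<open>i = 0\<close> the index \<open>i - 1\<close> is truncated to 0,
  where the sum is empty.\<close>

lemma s_seq_Suc: "s_seq c t (Suc i) = t i + int c * s_seq c t i - s_seq c t (i - 1)"
proof (cases i)
  case 0
  then show ?thesis by (simp add: s_seq_def)
next
  case (Suc k)
  have "a_seq c (Suc (Suc k) - j + 1) * t j =
      int c * (a_seq c (Suc k - j + 1) * t j) - a_seq c (k - j + 1) * t j" if "j < k" for j
    using that by (simp add: Suc_diff_le algebra_simps)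
  then have "(\<Sum>j<k. a_seq c (Suc (Suc k) - j + 1) * t j) =
      int c * (\<Sum>j<k. a_seq c (Suc k - j + 1) * t j) - (\<Sum>j<k. a_seq c (k - j + 1) * t j)"
    by (simp add: sum_distrib_left sum_subtractf)
  then show ?thesis
    using Suc by (simp add: s_seq_def numeral_3_eq_3 algebra_simps)
qed

text \<open>By d'Ocagne's identity \<open>a_k a_(m+1) \<le> a_m a_(k+1)\<close> for
  \<open>k \<le> m\<close>, which gives the claim termwise with \<open>k = m - j + 1\<close>. The
  term \<open>j = 0\<close> falls outside, hence \<open>t 0 = 0\<close>.\<close>

lemma s_seq_ratio_mono:
  assumes c: "c \<ge> 2" and t: "\<And>j. j < Suc m \<Longrightarrow> 0 \<le> t j" "t 0 = 0"
  shows "s_seq c t m * a_seq c (m + 1) \<le> a_seq c m * s_seq c t (m + 1)"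
proof (cases "m = 0")
  case True
  then show ?thesis using t by (simp add: s_seq_def)
next
  case False
  have "a_seq c (m - j + 1) * t j * a_seq c (m + 1) \<le> a_seq c m * (a_seq c (Suc m - j + 1) * t j)"
    if "j < m" for j
  proof (cases "j = 0")
    case False
    define d where "d = j - 1"
    define k where "k = m - j + 1"
    have m: "d + k = m" using that False by (simp add: d_def k_def)
    have "a_seq c k * a_seq c (m + 1) \<le> a_seq c m * a_seq c (Suc k)"
      using a_seq_dOcagne[of c d k] a_seq_nonneg[OF c, of "Suc d"] by (simp add: m)
    then have "a_seq c k * a_seq c (m + 1) * t j \<le> a_seq c m * a_seq c (Suc k) * t j"
      using t that by (intro mult_right_mono) auto
    moreover have "Suc m - j + 1 = Suc k" using that by (simp add: k_def)
    ultimately show ?thesis by (simp add: k_def mult_ac del: a_seq.simps)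
  qed (simp add: t)
  then have "s_seq c t m * a_seq c (m + 1) \<le> (\<Sum>j<m. a_seq c m * (a_seq c (Suc m - j + 1) * t j))"
    unfolding s_seq_def sum_distrib_right by (intro sum_mono) auto
  also have "\<dots> \<le> (\<Sum>j<Suc m. a_seq c m * (a_seq c (Suc m - j + 1) * t j))"
    using a_seq_nonneg[OF c, of m] False t by simp
  also have "\<dots> = a_seq c m * s_seq c t (m + 1)"
    by (simp only: s_seq_def sum_distrib_left Suc_eq_plus1)
  finally show ?thesis .
qed

lemma s_seq_nonneg:
  assumes "c \<ge> 2" "\<And>j. j < i \<Longrightarrow> 0 \<le> t j"
  shows "0 \<le> s_seq c t i"
  unfolding s_seq_def using assms a_seq_nonneg[OF assms(1)]
  by (intro sum_nonneg mult_nonneg_nonneg) auto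

section \<open>Admissible tuples and sums over them\<close>

definition feasible :: "nat \<Rightarrow> nat \<Rightarrow> (nat \<Rightarrow> int) set" where
  "feasible c m = {t \<in> extensional {0..<m}.
     \<forall>i\<in>{0..<m}. 0 \<le> t i \<and> t i \<le> a_seq c (i + 1) - int c * s_seq c t i}"

lemma feasible_fun_upd_iff:
  assumes "t \<in> extensional {0..<m}"
  shows "t(m := v) \<in> feasible c (Suc m) \<longleftrightarrow>
    t \<in> feasible c m \<and> v \<in> {0..a_seq c (m + 1) - int c * s_seq c t m}"
proof -
  let ?t = "t(m := v)"
  have ext: "?t \<in> extensional {0..<Suc m}"
    using assms by (simp add: extensional_def)
  have "(\<forall>i\<in>{0..<m}. 0 \<le> ?t i \<and> ?t i \<le> a_seq c (i + 1) - int c * s_seq c ?t i) \<longleftrightarrow>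
      (\<forall>i\<in>{0..<m}. 0 \<le> t i \<and> t i \<le> a_seq c (i + 1) - int c * s_seq c t i)"
    by (intro ball_cong refl) (simp add: s_seq_fun_upd)
  then show ?thesis
    using assms ext by (simp add: feasible_def atLeast0_lessThan_Suc s_seq_fun_upd conj_commute)
qed

lemma bij_betw_feasible_Suc:
  "bij_betw (\<lambda>(t, v). t(m := v))
     (SIGMA t:feasible c m. {0..a_seq c (m + 1) - int c * s_seq c t m}) (feasible c (Suc m))"
proof (rule bij_betw_byWitness[where f' = "\<lambda>t. (restrict t {0..<m}, t m)"])
  have ext: "t \<in> extensional {0..<m}" if "t \<in> feasible c m" for t m
    using that by (simp add: feasible_def)
  have upd: "(restrict t {0..<m})(m := t m) = t" if "t \<in> extensional {0..<Suc m}" for t :: "nat \<Rightarrow> int"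
    using that by (auto simp: extensional_def fun_eq_iff)
  show "\<forall>x\<in>(SIGMA t:feasible c m. {0..a_seq c (m + 1) - int c * s_seq c t m}).
      (restrict (case x of (t, v) \<Rightarrow> t(m := v)) {0..<m}, (case x of (t, v) \<Rightarrow> t(m := v)) m) = x"
    by (auto dest!: ext simp: extensional_def fun_eq_iff)
  show "\<forall>t\<in>feasible c (Suc m). (case (restrict t {0..<m}, t m) of (t, v) \<Rightarrow> t(m := v)) = t"
    by (simp only: prod.case) (blast intro: upd ext)
  show "(\<lambda>(t, v). t(m := v)) ` (SIGMA t:feasible c m. {0..a_seq c (m + 1) - int c * s_seq c t m})
      \<subseteq> feasible c (Suc m)"
    by (auto simp: feasible_fun_upd_iff[OF ext])
  show "(\<lambda>t. (restrict t {0..<m}, t m)) ` feasible c (Suc m)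
      \<subseteq> (SIGMA t:feasible c m. {0..a_seq c (m + 1) - int c * s_seq c t m})"
  proof safe
    fix t assume t: "t \<in> feasible c (Suc m)"
    then have "(restrict t {0..<m})(m := t m) \<in> feasible c (Suc m)"
      using upd[OF ext[OF t]] by simp
    then show "restrict t {0..<m} \<in> feasible c m"
      "t m \<in> {0..a_seq c (m + 1) - int c * s_seq c (restrict t {0..<m}) m}"
      by (simp_all only: feasible_fun_upd_iff[OF restrict_extensional])
  qed
qed

lemma feasible_0: "feasible c 0 = {\<lambda>_. undefined}"
  by (auto simp: feasible_def)

lemma finite_feasible: "finite (feasible c m)"
proof (induction m)
  case (Suc m)
  then show ?case
    using bij_betw_finite[OF bij_betw_feasible_Suc[of m c]] by auto
qed (simp add: feasible_0)

lemma sum_feasible_Suc: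
  "sum h (feasible c (Suc m)) =
    (\<Sum>t\<in>feasible c m. \<Sum>v\<in>{0..a_seq c (m + 1) - int c * s_seq c t m}. h (t(m := v)))"
proof -
  let ?S = "SIGMA t:feasible c m. {0..a_seq c (m + 1) - int c * s_seq c t m}"
  have "sum h (feasible c (Suc m)) = (\<Sum>x\<in>?S. h ((\<lambda>(t, v). t(m := v)) x))"
    by (rule sum.reindex_bij_betw[OF bij_betw_feasible_Suc, symmetric])
  also have "\<dots> = (\<Sum>(t, v)\<in>?S. h (t(m := v)))"
    by (simp add: case_prod_unfold)
  finally show ?thesis
    by (simp add: sum.Sigma finite_feasible)
qed

text \<open>Builds the range condition on \<open>e2\<close> into the inner binomial; it differs from
  \<open>gbinom_int\<close> only for \<open>A < 0\<close>.\<close>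

definition restr_binom :: "int \<Rightarrow> int \<Rightarrow> rat" where
  "restr_binom A k = (if 0 \<le> k \<and> k \<le> A then gbinom_int A k else 0)"

lemma restr_binom_neg: "A < 0 \<Longrightarrow> restr_binom A k = 0"
  by (simp add: restr_binom_def)

lemma restr_binom_nonneg: "0 \<le> A \<Longrightarrow> restr_binom A k = gbinom_int A k"
  by (auto simp: restr_binom_def gbinom_int_neg gbinom_int_gt)

definition weight :: "nat \<Rightarrow> nat \<Rightarrow> (nat \<Rightarrow> int) \<Rightarrow> rat" where
  "weight c m t = (\<Prod>i\<in>{0..<m}. mbinom (a_seq c (i + 1) - int c * s_seq c t i) (t i))"

lemma weight_fun_upd:
  "weight c (Suc m) (t(m := v)) = weight c m t * mbinom (a_seq c (m + 1) - int c * s_seq c t m) v"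
  by (simp add: weight_def s_seq_fun_upd)

text \<open>The sum over the \<open>t_i\<close> in the theorem for \<open>n = m + 3\<close> and
  fixed \<open>e1\<close>, \<open>e2\<close>, with the condition
  \<open>e2 a_(n-1) \<ge> e1 a_(n-2)\<close> left out.\<close>

definition feasible_sum :: "nat \<Rightarrow> nat \<Rightarrow> int \<Rightarrow> int \<Rightarrow> rat" where
  "feasible_sum c m e1 e2 = (\<Sum>t\<in>feasible c m. weight c m t
     * restr_binom (a_seq c (m + 1) - int c * s_seq c t m) (e2 - s_seq c t (m - 1))
     * gbinom_int (int c * e2 - a_seq c m) (e1 - s_seq c t m))"

lemma feasible_sum_0:
  "feasible_sum c 0 e1 e2 = (if e2 = 0 then gbinom_int 1 e1 else 0)"
  by (auto simp: feasible_sum_def feasible_0 s_seq_def restr_binom_def weight_def gbinom_int_0)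

lemma gbinom_int_1: "gbinom_int 1 k = (if k = 0 \<or> k = 1 then 1 else 0)"
  using gbinom_int_pascal[of 0 k] by (auto simp: gbinom_int_0)

text \<open>Summing over \<open>f = a\<^sub>m\<^sub>+\<^sub>1 - s\<^sub>m\<^sub>+\<^sub>1\<close> instead of the last variable \<open>t\<^sub>m\<close> makes the summands
  of index \<open>m + 1\<close> factor through those of index \<open>m\<close>.\<close>

lemma feasible_sum_Suc:
  assumes "finite J"
    and "\<And>t. t \<in> feasible c m \<Longrightarrow> {s_seq c t (m - 1)..s_seq c t (m - 1)
           + (a_seq c (m + 1) - int c * s_seq c t m)} \<subseteq> J"
  shows "feasible_sum c (Suc m) e1 e2 = (\<Sum>f\<in>J.
    (if a_seq c m \<le> int c * f then feasible_sum c m e2 f else 0)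
      * gbinom_int (int c * e2 - a_seq c (m + 1)) (e1 - a_seq c (m + 1) + f))"
proof -
  define A where "A t = a_seq c (m + 1) - int c * s_seq c t m" for t
  define \<sigma> where "\<sigma> t = s_seq c t (m - 1)" for t
  define g where "g f = gbinom_int (int c * e2 - a_seq c (m + 1)) (e1 - (a_seq c (m + 1) - f))" for f
  define H where "H t f = weight c m t * restr_binom (A t) (f - \<sigma> t)
      * restr_binom (int c * f - a_seq c m) (e2 - s_seq c t m) * g f" for t f
  have s: "s_seq c (t(m := v)) (Suc m) = a_seq c (m + 1) - (A t + \<sigma> t - v)" for t v
    by (simp add: s_seq_Suc s_seq_fun_upd A_def \<sigma>_def)
  \<comment> \<open>With \<open>f = A t + \<sigma> t - v\<close>, the factor for
    \<open>t_m = v\<close> becomes the inner binomial of index \<open>m\<close>. The inner binomial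
    of index \<open>m + 1\<close> gets upper entry \<open>c f - a_m\<close> and becomes the outer
    one of index \<open>m\<close>, restricted to nonnegative upper entries.\<close>
  have H: "weight c (Suc m) (t(m := v))
      * restr_binom (a_seq c (Suc m + 1) - int c * s_seq c (t(m := v)) (Suc m))
          (e2 - s_seq c (t(m := v)) (Suc m - 1))
      * gbinom_int (int c * e2 - a_seq c (Suc m)) (e1 - s_seq c (t(m := v)) (Suc m))
    = H t (A t + \<sigma> t - v)" if "v \<in> {0..A t}" for t v
  proof -
    have "a_seq c (Suc m + 1) - int c * (a_seq c (m + 1) - (A t + \<sigma> t - v)) =
        int c * (A t + \<sigma> t - v) - a_seq c m"
      by (simp add: algebra_simps)
    moreover have "a_seq c (Suc m) - int c * s_seq c t m = A t"
      by (simp add: A_def)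
    ultimately show ?thesis
      using that unfolding s weight_fun_upd H_def g_def
      by (simp add: s_seq_fun_upd mbinom_eq_gbinom_int restr_binom_def del: a_seq.simps)
  qed
  have "feasible_sum c (Suc m) e1 e2 = (\<Sum>t\<in>feasible c m. \<Sum>v\<in>{0..A t}. H t (A t + \<sigma> t - v))"
    unfolding feasible_sum_def sum_feasible_Suc A_def[symmetric]
    by (intro sum.cong refl H)
  also have "\<dots> = (\<Sum>t\<in>feasible c m. \<Sum>f\<in>{\<sigma> t..\<sigma> t + A t}. H t f)"
  proof (rule sum.cong[OF refl])
    show "(\<Sum>v\<in>{0..A t}. H t (A t + \<sigma> t - v)) = (\<Sum>f\<in>{\<sigma> t..\<sigma> t + A t}. H t f)" for t
      by (rule sum.reindex_bij_witness[where i = "\<lambda>f. A t + \<sigma> t - f" and j = "\<lambda>v. A t + \<sigma> t - v"])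
        auto
  qed
  also have "\<dots> = (\<Sum>t\<in>feasible c m. \<Sum>f\<in>J. H t f)"
    using assms by (intro sum.cong refl sum.mono_neutral_left)
      (auto simp: H_def A_def \<sigma>_def restr_binom_def)
  also have "\<dots> = (\<Sum>f\<in>J. \<Sum>t\<in>feasible c m. H t f)"
    by (rule sum.swap)
  also have "\<dots> = (\<Sum>f\<in>J. (if a_seq c m \<le> int c * f then feasible_sum c m e2 f else 0) * g f)"
    by (intro sum.cong refl)
      (auto simp: H_def feasible_sum_def A_def \<sigma>_def sum_distrib_right restr_binom_neg
        restr_binom_nonneg[of "int c * _ - _"])
  also have "g = (\<lambda>f. gbinom_int (int c * e2 - a_seq c (m + 1)) (e1 - a_seq c (m + 1) + f))"
    by (simp add: g_def fun_eq_iff algebra_simps)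
  finally show ?thesis .
qed

text \<open>In a nonzero summand \<open>f\<close> comes from an admissible \<open>t_m\<close> with
  \<open>s_(m+1) = a_(m+1) - f\<close>, and \<open>e2 - s_m \<le> c f - a_m\<close>. Bounding
  \<open>s_m\<close> by the ratio inequality yields
  \<open>e2 a_(m+1) \<le> f a_(m+2)\<close>.\<close>

lemma feasible_sum_eq_0:
  assumes c: "c \<ge> 2" and f: "a_seq c m \<le> int c * f" "f * a_seq c (m + 2) < e2 * a_seq c (m + 1)"
  shows "feasible_sum c m e2 f = 0"
  unfolding feasible_sum_def
proof (intro sum.neutral ballI)
  fix t assume t: "t \<in> feasible c m"
  define A where "A = a_seq c (m + 1) - int c * s_seq c t m"
  define v where "v = A - (f - s_seq c t (m - 1))"
  have "restr_binom A (f - s_seq c t (m - 1)) = 0 \<or>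
      gbinom_int (int c * f - a_seq c m) (e2 - s_seq c t m) = 0"
  proof (rule ccontr)
    assume nz: "\<not> ?thesis"
    then have "v \<in> {0..A}" by (auto simp: restr_binom_def v_def split: if_splits)
    then have t': "t(m := v) \<in> feasible c (Suc m)"
      using t feasible_fun_upd_iff[of t m v c] by (simp add: A_def feasible_def)
    have bd: "0 \<le> (t(m := v)) j"
      "(t(m := v)) j \<le> a_seq c (j + 1) - int c * s_seq c (t(m := v)) j" if "j < Suc m" for j
      using t' that unfolding feasible_def by auto
    \<comment> \<open>The first entry lies between 0 and \<open>a_1 = 0\<close>.\<close>
    have "(t(m := v)) 0 = 0" using bd[of 0] by (simp add: s_seq_def)
    then have "s_seq c (t(m := v)) m * a_seq c (m + 1) \<le> a_seq c m * s_seq c (t(m := v)) (m + 1)"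
      using bd(1) by (intro s_seq_ratio_mono c)
    moreover have "s_seq c (t(m := v)) (m + 1) = a_seq c (m + 1) - f"
      by (simp add: s_seq_Suc s_seq_fun_upd v_def A_def)
    ultimately have "s_seq c t m * a_seq c (m + 1) \<le> a_seq c m * (a_seq c (m + 1) - f)"
      by (simp only: s_seq_fun_upd order_refl)
    moreover have "e2 - s_seq c t m \<le> int c * f - a_seq c m"
      using nz gbinom_int_gt[of "int c * f - a_seq c m" "e2 - s_seq c t m"] f(1) by force
    then have "e2 * a_seq c (m + 1) \<le> (int c * f - a_seq c m + s_seq c t m) * a_seq c (m + 1)"
      using a_seq_nonneg[OF c, of "m + 1"] by (intro mult_right_mono) auto
    ultimately show False using f(2) by (simp add: algebra_simps)
  qed
  then show "weight c m t * restr_binom (a_seq c (m + 1) - int c * s_seq c t m) (f - s_seq c t (m - 1))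
      * gbinom_int (int c * f - a_seq c m) (e2 - s_seq c t m) = 0"
    by (auto simp: A_def)
qed

text \<open>Makes the lower entry of the outer binomial negative. For \<open>m > 0\<close>, writing
  \<open>a, b, d\<close> for the terms from \<open>a_(m+1)\<close> on, the last two hypotheses give
  \<open>a e1 \<le> f d\<close>, so
  \<open>a (e1 + f) \<le> f (a + d) = c f b < a_m b = a^2 - 1\<close>.\<close>

lemma small_f_bound:
  assumes c: "c \<ge> 2" and "int c * f < a_seq c m"
    and 1: "f * a_seq c (m + 2) \<ge> e2 * a_seq c (m + 1)"
    and 2: "e2 * a_seq c (m + 3) \<ge> e1 * a_seq c (m + 2)"
  shows "e1 + f < a_seq c (m + 1)"
proof (cases "m = 0")
  case True
  then have "f \<ge> 0" "int c * f < 0" using 1 assms(2) by (simp_all add: a_seq_2)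
  then show ?thesis by (simp add: mult_less_0_iff)
next
  case False
  let ?a = "a_seq c (m + 1)" and ?b = "a_seq c (m + 2)" and ?d = "a_seq c (m + 3)"
  have pos: "?a > 0" "?b > 0" "?d > 0" using a_seq_pos[OF c] False by (simp_all del: a_seq.simps)
  have d: "?d = int c * ?b - ?a" by (simp add: numeral_eq_Suc)
  have "?a * (e1 * ?b) \<le> ?a * (e2 * ?d)" using 2 pos by (intro mult_left_mono) auto
  moreover have "?d * (e2 * ?a) \<le> ?d * (f * ?b)" using 1 pos by (intro mult_left_mono) auto
  ultimately have "?b * (?a * (e1 + f)) \<le> ?b * (int c * f * ?b)"
    by (simp add: d algebra_simps)
  then have "?a * (e1 + f) \<le> int c * f * ?b" using pos by simp
  also have "\<dots> < a_seq c m * ?b" using assms(2) pos by simp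
  also have "\<dots> < ?a * ?a" using a_seq_Cassini[of c m] by (simp add: power2_eq_square)
  finally show ?thesis using pos by simp
qed

text \<open>Both recursions are compared term by term in \<open>f\<close>: if \<open>(e2, f)\<close>
  violates the degree inequality both terms vanish; otherwise either the induction hypothesis
  applies or \<open>c f < a_m\<close> and the outer binomial is 0.\<close>

lemma feasible_sum_eq_laurent_coeff:
  assumes c: "c \<ge> 2" and "e2 * a_seq c (m + 2) \<ge> e1 * a_seq c (m + 1)"
  shows "feasible_sum c m e1 e2 = of_int (laurent_coeff c m e1 e2)"
  using assms(2)
proof (induction m arbitrary: e1 e2)
  case 0
  then show ?case using c by (simp add: feasible_sum_0 laurent_coeff_0 gbinom_int_1)
next
  case (Suc m)
  define g where "g f = gbinom_int (int c * e2 - a_seq c (m + 1)) (e1 - a_seq c (m + 1) + f)" for f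
  define J where "J = (\<Union>t\<in>feasible c m. {s_seq c t (m - 1)..s_seq c t (m - 1)
      + (a_seq c (m + 1) - int c * s_seq c t m)}) \<union> {f. laurent_coeff c m e2 f \<noteq> 0}"
  have "finite {f. laurent_coeff c m e2 f \<noteq> 0}"
    by (rule finite_subset[OF _ finite_imageI[OF finite_laurent_coeff[of c m], of snd]])
      (use c in \<open>force simp: image_iff\<close>)+
  then have J: "finite J" by (simp add: J_def finite_feasible)
  have "feasible_sum c (Suc m) e1 e2 =
      (\<Sum>f\<in>J. (if a_seq c m \<le> int c * f then feasible_sum c m e2 f else 0) * g f)"
    unfolding g_def by (rule feasible_sum_Suc[OF J]) (auto simp: J_def)
  also have "\<dots> = (\<Sum>f\<in>J. of_int (laurent_coeff c m e2 f) * g f)"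
  proof (intro sum.cong refl)
    fix f
    show "(if a_seq c m \<le> int c * f then feasible_sum c m e2 f else 0) * g f =
        of_int (laurent_coeff c m e2 f) * g f"
    proof (cases "f * a_seq c (m + 2) < e2 * a_seq c (m + 1)")
      case True
      then show ?thesis using feasible_sum_eq_0[OF c] laurent_coeff_eq_0[OF c] by simp
    next
      case False
      show ?thesis
      proof (cases "a_seq c m \<le> int c * f")
        case True
        then show ?thesis using Suc.IH False by simp
      next
        case small: False
        have "e1 + f < a_seq c (m + 1)"
          using small_f_bound[OF c, of f m e2 e1] small False Suc.prems
          by (simp add: numeral_eq_Suc del: a_seq.simps)
        then show ?thesis using small by (simp add: g_def gbinom_int_neg)
      qed
    qed
  qed
  also have "\<dots> = of_int (laurent_coeff c (Suc m) e1 e2)"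
    unfolding g_def using c J by (intro laurent_coeff_Suc[symmetric]) (auto simp: J_def)
  finally show ?case .
qed

subsection \<open>The Laurent expansion of \<open>x\<^sub>n\<close>\<close>

lemma X_nonzero: "X1 \<noteq> 0" "X2 \<noteq> 0"
  by (rule pos_at_1_nonzero, rule pos_at_1_X)+

lemma cluster_var_eq_laurent_eval:
  assumes "c > 0" "n \<ge> 2"
  shows "cluster_var c c (int n) = laurent_eval X1 X2 (cluster_laurent c n)"
proof -
  have "cluster_var c c (int k) * cluster_var c c (int (k + 2)) =
      cluster_var c c (int (k + 1)) ^ c + 1" for k
    using cluster_var_exchange[of c c "int k + 1"] cluster_var_nonzero[of c c "int k"]
    by (simp add: add.commute)
  then show ?thesis
    using laurent_eval_cluster_laurent[of c "\<lambda>k. cluster_var c c (int k)" n] assms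
      cluster_var_nonzero X_nonzero
    by (simp add: cluster_var_1 cluster_var_2)
qed

lemma laurent_eval_eq_sum_laurent_coeff:
  assumes c: "c > 0" and E: "finite E" "{(e1, e2). laurent_coeff c m e1 e2 \<noteq> 0} \<subseteq> E"
  shows "laurent_eval u v (cluster_laurent c (m + 3)) =
    (\<Sum>(e1, e2)\<in>E. of_int (laurent_coeff c m e1 e2)
       * (u powi (a_seq c m - int c * e2) * v powi (int c * e1 - a_seq c (m + 1))))"
proof -
  let ?h = "\<lambda>(e1, e2). (a_seq c m - int c * e2, int c * e1 - a_seq c (m + 1))"
  have inj: "inj_on ?h E" using c by (auto simp: inj_on_def)
  have "k \<in> ?h ` E" if k: "k \<in> Poly_Mapping.keys (cluster_laurent c (m + 3))" for k
  proof -
    obtain p q where pq: "k = (p, q)" by (cases k)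
    obtain e2 where e2: "a_seq c m - p = int c * e2"
      using keys_cluster_laurent(1)[OF c k[unfolded pq]] by (rule dvdE)
    obtain e1 where e1: "q + a_seq c (m + 1) = int c * e1"
      using keys_cluster_laurent(2)[OF c k[unfolded pq]] by (rule dvdE)
    have "k = ?h (e1, e2)" using pq e1 e2 by simp
    moreover from this have "(e1, e2) \<in> E"
      using E(2) k by (auto simp: laurent_coeff_def in_keys_iff)
    ultimately show ?thesis by blast
  qed
  then have "laurent_eval u v (cluster_laurent c (m + 3)) = (\<Sum>(p, q)\<in>?h ` E.
      of_int (Poly_Mapping.lookup (cluster_laurent c (m + 3)) (p, q)) * (u powi p * v powi q))"
    using E(1) by (intro laurent_eval_superset) auto
  also have "\<dots> = (\<Sum>(e1, e2)\<in>E. of_int (laurent_coeff c m e1 e2)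
       * (u powi (a_seq c m - int c * e2) * v powi (int c * e1 - a_seq c (m + 1))))"
    using inj by (simp add: sum.reindex case_prod_unfold laurent_coeff_def)
  finally show ?thesis .
qed

section \<open>Rational constants and finiteness of the summation\<close>

lemma rf_const_0 [simp]: "rf_const 0 = 0"
  by (simp add: rf_const_def)

lemma rf_const_add: "rf_const (x + y) = rf_const x + rf_const y"
  by (simp add: rf_const_def flip: to_fract_add)

lemma rf_const_sum: "rf_const (\<Sum>i\<in>A. f i) = (\<Sum>i\<in>A. rf_const (f i))"
  by (induction A rule: infinite_finite_induct) (auto simp: rf_const_add)

lemma rf_const_of_int: "rf_const (of_int k) = of_int k"
proof -
  have nat: "rf_const (of_nat j) = of_nat j" for j
  proof (induction j)
    case (Suc j)
    then show ?case
      by (simp add: rf_const_add) (simp add: rf_const_def flip: one_pCons)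
  qed simp
  have "rf_const (- x) = - rf_const x" for x
    using rf_const_add[of x "- x"] by (simp add: eq_neg_iff_add_eq_0 add.commute)
  then show ?thesis
    by (cases k rule: int_cases2) (simp_all add: nat)
qed

text \<open>Needed for \<open>Sum_any\<close>. For each of the finitely many \<open>t\<close> the
  inner binomial bounds \<open>e2\<close>, the outer one gives \<open>e1 \<ge> s_m \<ge> 0\<close>,
  and the degree inequality bounds \<open>e1\<close> above when \<open>a_(m+1) \<ge> 1\<close>. For
  \<open>m = 0\<close>, where \<open>a_1 = 0\<close>, the outer binomial forces
  \<open>e1 \<le> 1\<close>, hence \<open>max 1\<close>.\<close>

lemma finite_feasible_support:
  assumes c: "c \<ge> 2"
  shows "finite {(e1, e2, t). t \<in> feasible c m
    \<and> restr_binom (a_seq c (m + 1) - int c * s_seq c t m) (e2 - s_seq c t (m - 1)) \<noteq> 0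
    \<and> gbinom_int (int c * e2 - a_seq c m) (e1 - s_seq c t m) \<noteq> 0
    \<and> e1 * a_seq c (m + 1) \<le> e2 * a_seq c (m + 2)}" (is "finite ?S")
proof -
  let ?I = "\<lambda>t. {s_seq c t (m - 1)..s_seq c t (m - 1) + (a_seq c (m + 1) - int c * s_seq c t m)}"
  let ?Z = "SIGMA t:feasible c m. SIGMA e2:?I t. {0..max 1 (e2 * a_seq c (m + 2))}"
  have "?S \<subseteq> (\<lambda>(t, e2, e1). (e1, e2, t)) ` ?Z"
  proof safe
    fix e1 e2 t
    assume t: "t \<in> feasible c m"
      and r: "restr_binom (a_seq c (m + 1) - int c * s_seq c t m) (e2 - s_seq c t (m - 1)) \<noteq> 0"
      and g: "gbinom_int (int c * e2 - a_seq c m) (e1 - s_seq c t m) \<noteq> 0"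
      and le: "e1 * a_seq c (m + 1) \<le> e2 * a_seq c (m + 2)"
    have e2: "e2 \<in> ?I t" using r by (auto simp: restr_binom_def split: if_splits)
    have "s_seq c t m \<ge> 0" using t by (intro s_seq_nonneg c) (auto simp: feasible_def)
    moreover have "e1 - s_seq c t m \<ge> 0" using g gbinom_int_neg by force
    ultimately have e1: "e1 \<ge> 0" by linarith
    have "e1 \<le> max 1 (e2 * a_seq c (m + 2))"
    proof (cases "m = 0")
      case True
      then show ?thesis using g e2 by (auto simp: s_seq_def gbinom_int_1 split: if_splits)
    next
      case False
      then have "e1 * 1 \<le> e1 * a_seq c (m + 1)"
        using a_seq_pos[OF c, of "m + 1"] e1 by (intro mult_left_mono) auto
      then show ?thesis using le by simp
    qed
    then have "(t, e2, e1) \<in> ?Z" using t e1 e2 by simp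
    then show "(e1, e2, t) \<in> (\<lambda>(t, e2, e1). (e1, e2, t)) ` ?Z" by force
  qed
  moreover have "finite ?Z" by (intro finite_SigmaI finite_feasible) auto
  ultimately show ?thesis by (meson finite_surj)
qed

theorem theorem1p4:
  fixes b c n :: nat
  assumes "b = c" and "c \<ge> 2" and "n \<ge> 3"
  shows "cluster_var b c (int n) =
    X1 powi (- a_seq c (n - 1)) * X2 powi (- a_seq c (n - 2)) *
    Sum_any (\<lambda>(e1 :: int, e2 :: int, t :: nat \<Rightarrow> int).
      if t \<in> extensional {0..<n - 3}
         \<and> (\<forall>i\<in>{0..<n - 3}. 0 \<le> t i \<and> t i \<le> a_seq c (i + 1) - int c * s_seq c t i)
         \<and> 0 \<le> a_seq c (n - 2) - int c * s_seq c t (n - 3) - e2 + s_seq c t (n - 4)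
         \<and> a_seq c (n - 2) - int c * s_seq c t (n - 3) - e2 + s_seq c t (n - 4)
              \<le> a_seq c (n - 2) - int c * s_seq c t (n - 3)
         \<and> e2 * a_seq c (n - 1) - e1 * a_seq c (n - 2) \<ge> 0
      then
        rf_const
          ((\<Prod>i\<in>{0..<n - 3}. mbinom (a_seq c (i + 1) - int c * s_seq c t i) (t i))
           * mbinom (a_seq c (n - 2) - int c * s_seq c t (n - 3))
                    (a_seq c (n - 2) - int c * s_seq c t (n - 3) - e2 + s_seq c t (n - 4))
           * mbinom (- a_seq c (n - 3) + int c * e2)
                    (- a_seq c (n - 3) + int c * e2 - e1 + s_seq c t (n - 3)))
        * X1 powi (int c * (a_seq c (n - 2) - e2)) * X2 powi (int c * e1)
      else 0)" (is "_ = ?mono * Sum_any ?g")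
proof -
  define m where "m = n - 3"
  \<comment> \<open>For \<open>n = 3\<close> both \<open>n - 4\<close> and \<open>m - 1\<close> are
    truncated to 0, where \<open>s_seq\<close> is an empty sum.\<close>
  have n: "n = m + 3" "n - 1 = m + 2" "n - 2 = m + 1" "n - 3 = m" "n - 4 = m - 1"
    using assms(3) by (auto simp: m_def)
  have c0: "c > 0" using assms(2) by simp
  define P where "P e1 e2 t = weight c m t
     * restr_binom (a_seq c (m + 1) - int c * s_seq c t m) (e2 - s_seq c t (m - 1))
     * gbinom_int (int c * e2 - a_seq c m) (e1 - s_seq c t m)" for e1 e2 t
  define M where "M e1 e2 = X1 powi (int c * (a_seq c (m + 1) - e2)) * X2 powi (int c * e1)"
    for e1 e2
  have mono: "?mono * M e1 e2 =
      X1 powi (a_seq c m - int c * e2) * X2 powi (int c * e1 - a_seq c (m + 1))" for e1 e2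
  proof -
    have "a_seq c m - int c * e2 = - a_seq c (m + 2) + int c * (a_seq c (m + 1) - e2)"
      by (simp add: algebra_simps)
    moreover have "int c * e1 - a_seq c (m + 1) = - a_seq c (m + 1) + int c * e1" by simp
    ultimately show ?thesis
      using X_nonzero unfolding n(2-5) M_def by (simp only: power_int_add mult_ac simp_thms)
  qed
  define g where "g = ?g"
  define le where "le e1 e2 \<longleftrightarrow> e1 * a_seq c (m + 1) \<le> e2 * a_seq c (m + 2)" for e1 e2
  have g: "g (e1, e2, t) = (if t \<in> feasible c m \<and> le e1 e2 then rf_const (P e1 e2 t) * M e1 e2 else 0)"
    for e1 e2 t
  proof -
    define A \<sigma> where "A = a_seq c (m + 1) - int c * s_seq c t m" and "\<sigma> = s_seq c t (m - 1)"
    have P: "P e1 e2 t = weight c m t * restr_binom A (e2 - \<sigma>)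
        * gbinom_int (int c * e2 - a_seq c m) (e1 - s_seq c t m)"
      by (simp only: P_def A_def \<sigma>_def)
    have W: "mbinom A (A - e2 + \<sigma>) = gbinom_int A (e2 - \<sigma>)"
      by (simp add: mbinom_eq_gbinom_int)
    have G: "mbinom (- a_seq c m + int c * e2) (- a_seq c m + int c * e2 - e1 + s_seq c t m) =
        gbinom_int (int c * e2 - a_seq c m) (e1 - s_seq c t m)"
      by (simp add: mbinom_eq_gbinom_int)
    have F: "t \<in> extensional {0..<m} \<and>
        (\<forall>i\<in>{0..<m}. 0 \<le> t i \<and> t i \<le> a_seq c (i + 1) - int c * s_seq c t i) \<and> R \<longleftrightarrow>
        t \<in> feasible c m \<and> R" for R
      by (simp only: feasible_def mem_Collect_eq conj_assoc)
    have range: "0 \<le> A - e2 + \<sigma> \<and> A - e2 + \<sigma> \<le> A \<and> R \<longleftrightarrow> (0 \<le> e2 - \<sigma> \<and> e2 - \<sigma> \<le> A) \<and> R" for R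
      by auto
    have le: "0 \<le> e2 * a_seq c (m + 2) - e1 * a_seq c (m + 1) \<longleftrightarrow> le e1 e2"
      by (simp only: le_def diff_ge_0_iff_ge)
    show ?thesis
      unfolding g_def n(2-5) prod.case A_def[symmetric] \<sigma>_def[symmetric] W G weight_def[symmetric] F range le
        P restr_binom_def M_def
      by (simp add: mult.assoc)
  qed
  define Z where "Z = {(e1, e2, t). t \<in> feasible c m
    \<and> restr_binom (a_seq c (m + 1) - int c * s_seq c t m) (e2 - s_seq c t (m - 1)) \<noteq> 0
    \<and> gbinom_int (int c * e2 - a_seq c m) (e1 - s_seq c t m) \<noteq> 0
    \<and> e1 * a_seq c (m + 1) \<le> e2 * a_seq c (m + 2)}"
  \<comment> \<open>Both the pairs from nonzero summands and those with a nonzero Laurent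
    coefficient, so that the two sums run over one finite set.\<close>
  define E where "E = (\<lambda>(e1, e2, t). (e1, e2)) ` Z \<union> {(e1, e2). laurent_coeff c m e1 e2 \<noteq> 0}"
  have finE: "finite E"
    unfolding E_def Z_def
    using finite_feasible_support[OF assms(2)] finite_laurent_coeff[OF c0] by blast
  let ?r = "\<lambda>((e1, e2), t). (e1, e2, t)"
  have "g x = 0" if "x \<notin> ?r ` (E \<times> feasible c m)" for x
  proof (rule ccontr)
    assume nz: "g x \<noteq> 0"
    obtain e1 e2 t where x: "x = (e1, e2, t)" by (cases x)
    have "t \<in> feasible c m" "le e1 e2" "P e1 e2 t \<noteq> 0"
      using nz unfolding x g by (auto split: if_splits)
    then have "(e1, e2, t) \<in> Z" by (auto simp: Z_def P_def le_def)
    then have "((e1, e2), t) \<in> E \<times> feasible c m"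
      using \<open>t \<in> feasible c m\<close> by (force simp: E_def)
    then show False using that unfolding x by force
  qed
  then have "Sum_any g = sum g (?r ` (E \<times> feasible c m))"
    by (intro Sum_any.expand_superset) (auto simp: finE finite_feasible)
  also have "\<dots> = (\<Sum>x\<in>E \<times> feasible c m. g (?r x))"
    by (subst sum.reindex) (auto simp: inj_on_def comp_def)
  also have "\<dots> = (\<Sum>(e1, e2)\<in>E. \<Sum>t\<in>feasible c m. g (e1, e2, t))"
    by (simp add: sum.cartesian_product case_prod_unfold)
  also have "\<dots> = (\<Sum>(e1, e2)\<in>E. of_int (laurent_coeff c m e1 e2) * M e1 e2)"
  proof (intro sum.cong refl, clarify)
    fix e1 e2
    have "(\<Sum>t\<in>feasible c m. g (e1, e2, t)) =
        (if le e1 e2 then rf_const (feasible_sum c m e1 e2) * M e1 e2 else 0)"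
      unfolding g by (simp add: feasible_sum_def P_def rf_const_sum sum_distrib_right)
    \<comment> \<open>Where \<open>le e1 e2\<close> fails, the coefficient vanishes by the degree
      bound.\<close>
    also have "\<dots> = of_int (laurent_coeff c m e1 e2) * M e1 e2"
      using feasible_sum_eq_laurent_coeff[OF assms(2)] laurent_coeff_eq_0[OF assms(2)]
      by (auto simp: le_def rf_const_of_int simp del: a_seq.simps)
    finally show "(\<Sum>t\<in>feasible c m. g (e1, e2, t)) = of_int (laurent_coeff c m e1 e2) * M e1 e2" .
  qed
  finally have "?mono * Sum_any g =
      (\<Sum>(e1, e2)\<in>E. of_int (laurent_coeff c m e1 e2) * (?mono * M e1 e2))"
    by (simp add: sum_distrib_left case_prod_unfold mult_ac)
  also have "\<dots> = laurent_eval X1 X2 (cluster_laurent c n)"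
    unfolding mono
    by (subst n(1), rule laurent_eval_eq_sum_laurent_coeff[OF c0 finE, symmetric])
      (auto simp: E_def)
  also have "\<dots> = cluster_var b c (int n)"
    using cluster_var_eq_laurent_eval[OF c0, of n] assms by simp
  finally show ?thesis unfolding g_def by (rule sym)
qed

end
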